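(* There is an absolute constant $K>0$ such that the following holds. Let $p\in[2,+\infty)$, $\alpha_p>0$, let $\mathcal{C}\subset\mathbb{R}^n$ be a nonempty compact convex set that is $\alpha_p$-strongly convex with respect to the $\ell_p$-norm, let $x^*\in\mathbb{R}^n\setminus\mathcal{C}$, and let $c_p=\operatorname{dist}_p(x^*,\mathcal{C})=\min_{y\in\mathcal{C}}\|y-x^*\|_p>0$. Let $f(x)=\frac12\|x-x^*\|_p^2$ for $x\in\mathbb{R}^n$, and run the Frank-Wolfe algorithm on $\min_{x\in\mathcal{C}}f(x)$, started at an arbitrary vertex of $\mathcal{C}$, with the closed-loop step-size strategy. Then the algorithm produces an iterate $x\in\mathcal{C}$ satisfying $$\|x-x^*\|_p^2-\operatorname{dist}_p(x^*,\mathcal{C})^2\leq\epsilon^2$$ whose cardinality is $\mathcal{O}\left(\frac{p}{c_p\alpha_p}\ln(1/\epsilon)\right)$; precisely, there is $\epsilon_0\in(0,1)$ (which may depend on $\mathcal{C},x^*,p,\alpha_p$) such that for every $\epsilon\in(0,\epsilon_0)$ the cardinality is at most $K\max\left\{1,\frac{p}{c_p\alpha_p}\ln(1/\epsilon)\right\}$.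
   Context: $\|\cdot\|_p$ is the $\ell_p$-norm on $\mathbb{R}^n$ and $\langle\cdot,\cdot\rangle$ the Euclidean inner product. Vertices of $\mathcal{C}$ are its extreme points. A set $\mathcal{C}$ is $\alpha$-strongly convex with respect to a norm $\|\cdot\|$ if $\alpha>0$ and for all $x,y\in\mathcal{C}$, $\gamma\in[0,1]$, and $z\in\mathbb{R}^n$ with $\|z\|=1$, we have $(1-\gamma)x+\gamma y+(1-\gamma)\gamma\alpha\|x-y\|^2z\in\mathcal{C}$. Frank-Wolfe algorithm (FW) for a differentiable function $f$ over $\mathcal{C}$: start at a vertex $x_0$ of $\mathcal{C}$; for $t=0,1,2,\ldots$ let $v_t$ be a vertex of $\mathcal{C}$ belonging to $\arg\min_{v\in\mathcal{C}}\langle v,\nabla f(x_t)\rangle$, and set $x_{t+1}=x_t+\gamma_t(v_t-x_t)$ with $\gamma_t\in[0,1]$. Here, for $x\neq x^*$, the $i$-th entry of $\nabla f(x)$ is $\|x-x^*\|_p^{2-p}\operatorname{sign}([x-x^*]_i)|[x-x^*]_i|^{p-1}$. Closed-loop strategy: $\gamma_t=\min\left\{\frac{\langle x_t-v_t,\nabla f(x_t)\rangle}{(p-1)\|x_t-v_t\|_p^2},1\right\}$ (if $v_t=x_t$, the value of $\gamma_t$ is irrelevant). Each iterate $x_{t+1}=(1-\gamma_t)x_t+\gamma_tv_t$ comes with an explicit convex decomposition over $x_0,v_0,\ldots,v_t$. The cardinality of an iterate is the number of distinct vertices with positive weight in this decomposition. *)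

theory Defs
  imports "HOL-Analysis.Analysis" "HOL-Library.Function_Algebras"
begin

text \<open>
  The constant of the theorem must not depend on the dimension \<open>n\<close>, so \<open>n\<close> is
  quantified inside the statement and cannot be the cardinality of an index type. All spaces
  \<open>\<real>\<^sup>n\<close> therefore live in the single type \<^typ>\<open>nat \<Rightarrow> real\<close>, as the sequences vanishing from
  index \<open>n\<close> on. With the pointwise vector space structure below, the library notions
  \<^const>\<open>convex\<close> and \<^const>\<open>extreme_point_of\<close> apply. The topology on \<^typ>\<open>nat \<Rightarrow> real\<close> is that of
  pointwise convergence; on \<open>Rn n\<close> it is the usual topology of \<open>\<real>\<^sup>n\<close>, so that \<^const>\<open>compact\<close> has
  its usual meaning there.
\<close>

instantiation "fun" :: (type, real_vector) real_vector
begin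

definition scaleR_fun :: "real \<Rightarrow> ('a \<Rightarrow> 'b) \<Rightarrow> 'a \<Rightarrow> 'b"
  where "scaleR_fun r f = (\<lambda>i. r *\<^sub>R f i)"

instance
  by standard (simp_all add: scaleR_fun_def fun_eq_iff scaleR_add_right scaleR_add_left)

end

lemma scaleR_fun_apply [simp]: "(r *\<^sub>R f) i = r *\<^sub>R f i"
  by (simp add: scaleR_fun_def)

definition Rn :: "nat \<Rightarrow> (nat \<Rightarrow> real) set"
  where "Rn n = {x. \<forall>i\<ge>n. x i = 0}"

definition Rn_inner :: "nat \<Rightarrow> (nat \<Rightarrow> real) \<Rightarrow> (nat \<Rightarrow> real) \<Rightarrow> real"
  where "Rn_inner n x y = (\<Sum>i<n. x i * y i)"

definition lp_norm :: "nat \<Rightarrow> real \<Rightarrow> (nat \<Rightarrow> real) \<Rightarrow> real"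
  where "lp_norm n p x = (\<Sum>i<n. \<bar>x i\<bar> powr p) powr (1 / p)"

definition lp_dist :: "nat \<Rightarrow> real \<Rightarrow> (nat \<Rightarrow> real) \<Rightarrow> (nat \<Rightarrow> real) set \<Rightarrow> real"
  where "lp_dist n p a S = (INF y\<in>S. lp_norm n p (y - a))"

definition strongly_convex ::
    "nat \<Rightarrow> ((nat \<Rightarrow> real) \<Rightarrow> real) \<Rightarrow> real \<Rightarrow> (nat \<Rightarrow> real) set \<Rightarrow> bool"
  where "strongly_convex n N \<alpha> C \<longleftrightarrow> \<alpha> > 0 \<and>
    (\<forall>x\<in>C. \<forall>y\<in>C. \<forall>\<gamma>\<in>{0..1}. \<forall>z\<in>Rn n. N z = 1 \<longrightarrow>
      (1 - \<gamma>) *\<^sub>R x + \<gamma> *\<^sub>R y + ((1 - \<gamma>) * \<gamma> * \<alpha> * (N (x - y))\<^sup>2) *\<^sub>R z \<in> C)"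

text \<open>The vector of partial derivatives, which is the gradient where \<open>f\<close> is differentiable.\<close>

definition gradient :: "nat \<Rightarrow> ((nat \<Rightarrow> real) \<Rightarrow> real) \<Rightarrow> (nat \<Rightarrow> real) \<Rightarrow> (nat \<Rightarrow> real)"
  where "gradient n f x = (\<lambda>i. if i < n then deriv (\<lambda>s. f (x(i := s))) (x i) else 0)"

text \<open>
  \<open>X t\<close>, \<open>V t\<close> and \<open>\<gamma> t\<close> are the iterate, the vertex selected by the linear minimization, and the
  step size at step \<open>t\<close>. It is a relation because the initial vertex and each minimizing vertex
  are arbitrary choices.
\<close>

definition frank_wolfe ::
    "nat \<Rightarrow> ((nat \<Rightarrow> real) \<Rightarrow> real) \<Rightarrow> (nat \<Rightarrow> real) set \<Rightarrow>
     (nat \<Rightarrow> nat \<Rightarrow> real) \<Rightarrow> (nat \<Rightarrow> nat \<Rightarrow> real) \<Rightarrow> (nat \<Rightarrow> real) \<Rightarrow> bool"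
  where "frank_wolfe n f C X V \<gamma> \<longleftrightarrow>
    X 0 extreme_point_of C \<and>
    (\<forall>t. V t extreme_point_of C \<and>
         is_arg_min (\<lambda>v. Rn_inner n v (gradient n f (X t))) (\<lambda>v. v \<in> C) (V t) \<and>
         \<gamma> t \<in> {0..1} \<and>
         X (Suc t) = X t + \<gamma> t *\<^sub>R (V t - X t))"

text \<open>The step size is left unconstrained when \<open>V t = X t\<close>, where it does not affect the iterates.\<close>

definition closed_loop ::
    "nat \<Rightarrow> real \<Rightarrow> ((nat \<Rightarrow> real) \<Rightarrow> real) \<Rightarrow>
     (nat \<Rightarrow> nat \<Rightarrow> real) \<Rightarrow> (nat \<Rightarrow> nat \<Rightarrow> real) \<Rightarrow> (nat \<Rightarrow> real) \<Rightarrow> bool"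
  where "closed_loop n p f X V \<gamma> \<longleftrightarrow>
    (\<forall>t. V t \<noteq> X t \<longrightarrow>
      \<gamma> t = min (Rn_inner n (X t - V t) (gradient n f (X t)) /
                  ((p - 1) * (lp_norm n p (X t - V t))\<^sup>2)) 1)"

text \<open>
  Total weight of the point \<open>u\<close> in the convex decomposition of the iterate \<open>t\<close> obtained by unrolling
  \<open>x\<^sub>t\<^sub>+\<^sub>1 = (1 - \<gamma>\<^sub>t) x\<^sub>t + \<gamma>\<^sub>t v\<^sub>t\<close> from \<open>x\<^sub>0 = x0\<close>; the weights of equal vertices are added up.
\<close>

primrec fw_weight ::
    "'a \<Rightarrow> (nat \<Rightarrow> 'a) \<Rightarrow> (nat \<Rightarrow> real) \<Rightarrow> nat \<Rightarrow> 'a \<Rightarrow> real"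
  where
    "fw_weight x0 V \<gamma> 0 u = (if u = x0 then 1 else 0)"
  | "fw_weight x0 V \<gamma> (Suc t) u =
       (1 - \<gamma> t) * fw_weight x0 V \<gamma> t u + (if u = V t then \<gamma> t else 0)"

definition fw_cardinality :: "'a \<Rightarrow> (nat \<Rightarrow> 'a) \<Rightarrow> (nat \<Rightarrow> real) \<Rightarrow> nat \<Rightarrow> nat"
  where "fw_cardinality x0 V \<gamma> t = card {u \<in> insert x0 (V ` {..<t}). fw_weight x0 V \<gamma> t u > 0}"

lemma fw_weight_decomposition:
  assumes "frank_wolfe n f C X V \<gamma>" and "finite A" and "insert (X 0) (V ` {..<t}) \<subseteq> A"
  shows "(\<Sum>u\<in>A. fw_weight (X 0) V \<gamma> t u) = 1"
    and "(\<Sum>u\<in>A. fw_weight (X 0) V \<gamma> t u *\<^sub>R u) = X t"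
proof -
  have "(\<Sum>u\<in>A. fw_weight (X 0) V \<gamma> t u) = 1 \<and>
        (\<Sum>u\<in>A. fw_weight (X 0) V \<gamma> t u *\<^sub>R u) = X t"
    using assms(3)
  proof (induction t)
    case 0
    have *: "fw_weight (X 0) V \<gamma> 0 u *\<^sub>R u = (if u = X 0 then u else 0)" for u
      by simp
    show ?case
      using 0 assms(2) unfolding * by (simp add: sum.delta)
  next
    case (Suc t)
    have sub: "insert (X 0) (V ` {..<t}) \<subseteq> A" and VA: "V t \<in> A"
      using Suc.prems by auto
    have step: "X (Suc t) = X t + \<gamma> t *\<^sub>R (V t - X t)"
      using assms(1) by (simp add: frank_wolfe_def)
    have *: "fw_weight (X 0) V \<gamma> (Suc t) u *\<^sub>R u =
        (1 - \<gamma> t) *\<^sub>R (fw_weight (X 0) V \<gamma> t u *\<^sub>R u) + (if u = V t then \<gamma> t *\<^sub>R u else 0)" for u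
      by (simp add: scaleR_add_left)
    have 1: "(\<Sum>u\<in>A. fw_weight (X 0) V \<gamma> (Suc t) u) = 1"
      using Suc.IH[OF sub] VA assms(2)
      by (simp add: sum.distrib sum_distrib_left[symmetric] sum.delta)
    have 2: "(\<Sum>u\<in>A. fw_weight (X 0) V \<gamma> (Suc t) u *\<^sub>R u) = (1 - \<gamma> t) *\<^sub>R X t + \<gamma> t *\<^sub>R V t"
      unfolding * sum.distrib scaleR_sum_right[symmetric]
      using Suc.IH[OF sub] VA assms(2) by (simp only: sum.delta if_True)
    show ?case
      unfolding 1 2 step by (simp add: fun_eq_iff algebra_simps)
  qed
  then show "(\<Sum>u\<in>A. fw_weight (X 0) V \<gamma> t u) = 1"
    and "(\<Sum>u\<in>A. fw_weight (X 0) V \<gamma> t u *\<^sub>R u) = X t" by auto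
qed

lemma has_real_derivative_abs_powr:
  fixes p a s :: real
  assumes "p > 1"
  shows "((\<lambda>s. \<bar>s - a\<bar> powr p) has_real_derivative p * (sgn (s - a) * \<bar>s - a\<bar> powr (p - 1))) (at s)"
proof -
  consider "s > a" | "s < a" | "s = a" by linarith
  then show ?thesis
  proof cases
    case 1
    have "((\<lambda>s. (s - a) powr p) has_real_derivative p * (s - a) powr (p - 1)) (at s)"
      using 1 by (auto intro!: derivative_eq_intros)
    then show ?thesis
      by (rule has_field_derivative_transform_within[where d = "s - a", THEN DERIV_cong])
         (use 1 in \<open>auto simp: dist_real_def\<close>)
  next
    case 2
    have "((\<lambda>s. (a - s) powr p) has_real_derivative - (p * (a - s) powr (p - 1))) (at s)"
      using 2 by (auto intro!: derivative_eq_intros)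
    then show ?thesis
      by (rule has_field_derivative_transform_within[where d = "a - s", THEN DERIV_cong])
         (use 2 in \<open>auto simp: dist_real_def\<close>)
  next
    case 3
    have "((\<lambda>h::real. \<bar>h\<bar> powr (p - 1)) \<longlongrightarrow> 0 powr (p - 1)) (at 0)"
      using assms by (intro tendsto_powr' tendsto_rabs_zero tendsto_const) (auto intro: tendsto_ident_at)
    then have "((\<lambda>h::real. norm (\<bar>h\<bar> powr (p - 1))) \<longlongrightarrow> 0) (at 0)"
      by simp
    moreover have "norm (\<bar>h\<bar> powr (p - 1)) = norm (\<bar>h\<bar> powr p / h)" if "h \<noteq> 0" for h :: real
      using that by (simp add: powr_diff)
    ultimately have "((\<lambda>h::real. norm (\<bar>h\<bar> powr p / h)) \<longlongrightarrow> 0) (at 0)"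
      by (auto elim!: Lim_transform_eventually simp: eventually_at_filter)
    then have "((\<lambda>h::real. \<bar>h\<bar> powr p / h) \<longlongrightarrow> 0) (at 0)"
      by (rule tendsto_norm_zero_cancel)
    then show ?thesis
      using 3 assms by (simp add: DERIV_def)
  qed
qed

lemma gradient_half_lp_norm_sq:
  assumes p: "2 \<le> p" and x: "x \<in> Rn n" "xs \<in> Rn n" "x \<noteq> xs" and i: "i < n"
  shows "gradient n (\<lambda>x. (lp_norm n p (x - xs))\<^sup>2 / 2) x i =
    lp_norm n p (x - xs) powr (2 - p) * sgn (x i - xs i) * \<bar>x i - xs i\<bar> powr (p - 1)"
proof -
  define S where "S = (\<Sum>j<n. \<bar>x j - xs j\<bar> powr p)"
  obtain j where "x j \<noteq> xs j" using x(3) by auto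
  then have "j < n" using x(1,2) by (force simp: Rn_def not_less[symmetric])
  have "S > 0"
    unfolding S_def using \<open>j < n\<close> \<open>x j \<noteq> xs j\<close> by (intro sum_pos2[of _ j]) auto
  define B where "B = (\<Sum>j\<in>{..<n} - {i}. \<bar>x j - xs j\<bar> powr p)"
  have SB: "S = \<bar>x i - xs i\<bar> powr p + B"
    unfolding S_def B_def using i by (simp add: sum.remove)
  have eq: "(\<lambda>s. (lp_norm n p (x(i := s) - xs))\<^sup>2 / 2) =
      (\<lambda>s. (\<bar>s - xs i\<bar> powr p + B) powr (2 / p) / 2)"
  proof
    fix s
    have "(\<Sum>j<n. \<bar>(x(i := s) - xs) j\<bar> powr p) = \<bar>s - xs i\<bar> powr p + B"
      unfolding B_def using i by (subst sum.remove[of _ i]) (auto intro!: sum.cong)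
    then show "(lp_norm n p (x(i := s) - xs))\<^sup>2 / 2 = (\<bar>s - xs i\<bar> powr p + B) powr (2 / p) / 2"
      by (simp add: lp_norm_def power2_eq_square powr_add[symmetric])
  qed
  have "((\<lambda>s. \<bar>s - xs i\<bar> powr p + B) has_real_derivative
      p * (sgn (x i - xs i) * \<bar>x i - xs i\<bar> powr (p - 1))) (at (x i))"
    using DERIV_add[OF has_real_derivative_abs_powr DERIV_const] p by simp
  from DERIV_cdivide[OF DERIV_chain2[OF has_real_derivative_powr this, of "2 / p"], of 2]
  have "((\<lambda>s. (\<bar>s - xs i\<bar> powr p + B) powr (2 / p) / 2) has_real_derivative
      (2 / p * S powr (2 / p - 1)) * (p * (sgn (x i - xs i) * \<bar>x i - xs i\<bar> powr (p - 1))) / 2) (at (x i))"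
    using \<open>S > 0\<close> SB by simp
  moreover have "lp_norm n p (x - xs) powr (2 - p) = S powr (2 / p - 1)"
    using p by (simp add: lp_norm_def S_def powr_powr field_simps)
  ultimately show ?thesis
    using p i by (simp add: gradient_def eq DERIV_imp_deriv)
qed

end

theory Submission
  imports Defs
begin

text \<open>
  Write \<open>N\<close> for the \<open>\<ell>\<^sub>p\<close>-norm, \<open>w = x - x\<^sup>*\<close>, and \<open>J w\<close> for the gradient of \<open>N\<^sup>2 / 2\<close> at \<open>w\<close>. Let
  \<open>h = N(w)\<^sup>2 - c\<^sup>2\<close> be (twice) the primal gap at an iterate \<open>x\<close> with selected vertex \<open>v\<close>,
  \<open>g = \<langle>x - v, J w\<rangle>\<close> the Frank-Wolfe gap, and \<open>D = N(x - v)\<^sup>2\<close>. Three inequalities drive the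
  proof.

  \<^item> Convexity of \<open>N\<^sup>2\<close> and minimality of \<open>v\<close> give \<open>h \<le> 2 g\<close> (\<open>lp_norm_square_supporting\<close>).

  \<^item> For \<open>p \<ge> 2\<close> the function \<open>N\<^sup>2 / 2\<close> is \<open>(p - 1)\<close>-smooth with respect to \<open>N\<close> itself
    (\<open>lp_norm_square_smooth\<close>). The closed-loop step \<open>\<gamma>\<close> is at most \<open>g / ((p - 1) D)\<close>, so
    moving by \<open>\<gamma>\<close> lowers \<open>h\<close> by at least \<open>2 \<gamma> g - (p - 1) \<gamma>\<^sup>2 D \<ge> \<gamma> g\<close>.

  \<^item> Strong convexity allows the segment from \<open>x\<close> to \<open>v\<close> to be pushed into the direction \<open>- w\<close>,
    which \<open>J w\<close> sees at full strength; minimality of \<open>v\<close> then forces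
    \<open>g \<ge> \<alpha> D N(w) \<ge> \<alpha> c D\<close> (\<open>strongly_convex_linear_minimization_gap\<close>).

  The last inequality bounds the step size from below by \<open>\<rho> = min 1 (\<alpha> c / (p - 1))\<close>, since \<open>D\<close>
  cancels in the quotient defining \<open>\<gamma>\<close>. Hence \<open>h\<close> contracts by the factor \<open>1 - \<rho> / 2\<close> in every
  iteration (\<open>frank_wolfe_step_contraction\<close>), and \<open>O(ln (1 / \<epsilon>) / \<rho>)\<close> iterations suffice once
  \<open>1 / \<epsilon>\<close> exceeds the largest value of \<open>h\<close> on \<open>C\<close>.

  An iterate has at most one vertex more than the number of iterations made. If
  \<open>\<alpha> c < p - 1\<close>, then \<open>1 / \<rho> \<le> p / (c \<alpha>)\<close> and counting iterations proves the claim. If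
  \<open>\<alpha> c \<ge> p - 1\<close>, then \<open>1 / \<rho> = 1\<close> may be far larger than \<open>p / (c \<alpha>)\<close>, so counting iterations
  is not enough. But then the lower bound on the step size says that all steps are full steps, and
  every iterate is a single vertex (\<open>fw_cardinality_full_steps\<close>).
\<close>

section \<open>The Hoelder inequality and the \<open>\<ell>\<^sub>p\<close>-norm\<close>

text \<open>
  Hoelder's inequality with the exponents \<open>1 / \<theta>\<close> and \<open>1 / (1 - \<theta>)\<close>, by Young's inequality after
  normalising both sums to one. It is used for \<open>\<theta> = 1 / p\<close> (duality of the norms) and for
  \<open>\<theta> = 2 / p\<close> (bound on the second derivative of the squared norm).
\<close>

lemma sum_powr_holder:
  fixes a b :: "'a \<Rightarrow> real"
  assumes fin: "finite A" and \<theta>: "0 < \<theta>" "\<theta> < 1"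
    and a: "\<And>i. i \<in> A \<Longrightarrow> 0 \<le> a i" and b: "\<And>i. i \<in> A \<Longrightarrow> 0 \<le> b i"
  shows "(\<Sum>i\<in>A. a i powr \<theta> * b i powr (1 - \<theta>)) \<le> sum a A powr \<theta> * sum b A powr (1 - \<theta>)"
proof -
  have nonneg: "sum a A \<ge> 0" "sum b A \<ge> 0"
    using a b by (auto intro: sum_nonneg)
  show ?thesis
  proof (cases "sum a A = 0 \<or> sum b A = 0")
    case True
    then have "(\<forall>i\<in>A. a i = 0) \<or> (\<forall>i\<in>A. b i = 0)"
      using fin a b by (auto simp: sum_nonneg_eq_0_iff)
    then have "(\<Sum>i\<in>A. a i powr \<theta> * b i powr (1 - \<theta>)) = 0"
      by (auto intro!: sum.neutral)
    then show ?thesis by simp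
  next
    case False
    define P Q where "P = sum a A" and "Q = sum b A"
    have PQ: "P > 0" "Q > 0"
      using False nonneg by (auto simp: P_def Q_def)
    have "a i powr \<theta> * b i powr (1 - \<theta>)
        \<le> P powr \<theta> * Q powr (1 - \<theta>) * (\<theta> * (a i / P) + (1 - \<theta>) * (b i / Q))" if i: "i \<in> A" for i
    proof (cases "a i = 0 \<or> b i = 0")
      case True
      then have "a i powr \<theta> * b i powr (1 - \<theta>) = 0" by auto
      also have "\<dots> \<le> P powr \<theta> * Q powr (1 - \<theta>) * (\<theta> * (a i / P) + (1 - \<theta>) * (b i / Q))"
        using PQ a[OF i] b[OF i] \<theta> by (intro mult_nonneg_nonneg add_nonneg_nonneg) auto
      finally show ?thesis .
    next
      case False
      then have pos: "a i > 0" "b i > 0" using a[OF i] b[OF i] by auto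
      have "a i powr \<theta> * b i powr (1 - \<theta>)
          = P powr \<theta> * Q powr (1 - \<theta>) * ((a i / P) powr \<theta> * (b i / Q) powr (1 - \<theta>))"
        using PQ pos by (simp add: powr_divide)
      also have "\<dots> \<le> P powr \<theta> * Q powr (1 - \<theta>) * (\<theta> * (a i / P) + (1 - \<theta>) * (b i / Q))"
        using \<theta> PQ pos by (intro mult_left_mono Youngs_inequality_0) auto
      finally show ?thesis .
    qed
    then have "(\<Sum>i\<in>A. a i powr \<theta> * b i powr (1 - \<theta>))
        \<le> (\<Sum>i\<in>A. P powr \<theta> * Q powr (1 - \<theta>) * (\<theta> * (a i / P) + (1 - \<theta>) * (b i / Q)))"
      by (rule sum_mono)
    also have "\<dots> = P powr \<theta> * Q powr (1 - \<theta>) * (\<theta> * (P / P) + (1 - \<theta>) * (Q / Q))"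
      by (simp add: sum_distrib_left[symmetric] sum.distrib P_def Q_def sum_divide_distrib[symmetric])
    also have "\<dots> = P powr \<theta> * Q powr (1 - \<theta>)"
      using PQ by simp
    finally show ?thesis by (simp add: P_def Q_def)
  qed
qed

lemma lp_norm_cong: "(\<And>i. i < n \<Longrightarrow> u i = w i) \<Longrightarrow> lp_norm n p u = lp_norm n p w"
  by (simp add: lp_norm_def)

lemma lp_norm_nonneg: "0 \<le> lp_norm n p w"
  by (simp add: lp_norm_def)

lemma lp_norm_scaleR:
  assumes "p \<noteq> 0"
  shows "lp_norm n p (r *\<^sub>R w) = \<bar>r\<bar> * lp_norm n p w"
  using assms
  by (simp add: lp_norm_def abs_mult powr_mult sum_distrib_left[symmetric] sum_nonneg powr_powr)

lemma lp_norm_square: "(lp_norm n p w)\<^sup>2 = (\<Sum>i<n. \<bar>w i\<bar> powr p) powr (2 / p)"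
  by (simp add: lp_norm_def power2_eq_square powr_add[symmetric])

lemma lp_norm_eq_0_iff: "lp_norm n p w = 0 \<longleftrightarrow> (\<forall>i<n. w i = 0)"
  by (auto simp: lp_norm_def sum_nonneg_eq_0_iff)

lemma lp_norm_diff_eq_0_iff:
  assumes "u \<in> Rn n" "v \<in> Rn n"
  shows "lp_norm n p (u - v) = 0 \<longleftrightarrow> u = v"
proof
  assume "lp_norm n p (u - v) = 0"
  then have "u i = v i" for i
    using assms by (cases "i < n") (simp_all add: lp_norm_eq_0_iff Rn_def)
  then show "u = v" by auto
qed (simp add: lp_norm_eq_0_iff)

lemma Rn_inner_diff_left: "Rn_inner n (u - v) w = Rn_inner n u w - Rn_inner n v w"
  by (simp add: Rn_inner_def algebra_simps sum_subtractf)

lemma Rn_inner_add_left: "Rn_inner n (u + v) w = Rn_inner n u w + Rn_inner n v w"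
  by (simp add: Rn_inner_def algebra_simps sum.distrib)

lemma Rn_inner_scaleR_left: "Rn_inner n (r *\<^sub>R u) w = r * Rn_inner n u w"
  by (simp add: Rn_inner_def sum_distrib_left mult.assoc)

lemma mult_abs_powr: "x * \<bar>x\<bar> powr (p - 2) = sgn x * \<bar>x\<bar> powr (p - 1)" for x p :: real
proof (cases "x = 0")
  case False
  have "x * \<bar>x\<bar> powr (p - 2) = sgn x * (\<bar>x\<bar> * \<bar>x\<bar> powr (p - 2))"
    by (simp add: mult.assoc[symmetric] sgn_mult_abs)
  also have "\<bar>x\<bar> * \<bar>x\<bar> powr (p - 2) = \<bar>x\<bar> powr (p - 1)"
    using False by (simp add: powr_mult_base)
  finally show ?thesis .
qed simp

section \<open>The gradient of the squared norm\<close>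

text \<open>
  The gradient of \<open>\<parallel>w\<parallel>\<^sub>p\<^sup>2 / 2\<close>. The factor \<open>sign(w\<^sub>i) \<bar>w\<^sub>i\<bar>\<^sup>p\<^sup>-\<^sup>1\<close> is written as
  \<open>w\<^sub>i \<bar>w\<^sub>i\<bar>\<^sup>p\<^sup>-\<^sup>2\<close>, which is easier to differentiate.
\<close>

definition lp_duality_map :: "nat \<Rightarrow> real \<Rightarrow> (nat \<Rightarrow> real) \<Rightarrow> nat \<Rightarrow> real"
  where "lp_duality_map n p w = (\<lambda>i. lp_norm n p w powr (2 - p) * (w i * \<bar>w i\<bar> powr (p - 2)))"

lemma Rn_inner_lp_duality_map:
  "Rn_inner n u (lp_duality_map n p w)
    = lp_norm n p w powr (2 - p) * (\<Sum>i<n. u i * (w i * \<bar>w i\<bar> powr (p - 2)))"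
  by (simp add: Rn_inner_def lp_duality_map_def sum_distrib_left mult_ac)

lemma abs_powr_minus_two: "x * (x * \<bar>x\<bar> powr (p - 2)) = \<bar>x\<bar> powr p" for x p :: real
proof (cases "x = 0")
  case False
  have "x * (x * \<bar>x\<bar> powr (p - 2)) = \<bar>x\<bar> powr 2 * \<bar>x\<bar> powr (p - 2)"
    using False by (simp add: power2_eq_square)
  also have "\<dots> = \<bar>x\<bar> powr p"
    by (subst powr_add[symmetric]) simp
  finally show ?thesis .
qed simp

lemma lp_norm_powr_p:
  assumes "p \<noteq> 0"
  shows "lp_norm n p w powr p = (\<Sum>i<n. \<bar>w i\<bar> powr p)"
  using assms by (simp add: lp_norm_def powr_powr sum_nonneg)

lemma Rn_inner_lp_duality_map_self:
  assumes "p \<ge> 2"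
  shows "Rn_inner n w (lp_duality_map n p w) = (lp_norm n p w)\<^sup>2"
proof -
  have "Rn_inner n w (lp_duality_map n p w) = lp_norm n p w powr (2 - p) * lp_norm n p w powr p"
    using assms by (simp add: Rn_inner_lp_duality_map abs_powr_minus_two lp_norm_powr_p)
  also have "\<dots> = (lp_norm n p w)\<^sup>2"
    using lp_norm_nonneg[of n p w] by (cases "lp_norm n p w = 0") (auto simp: powr_add[symmetric])
  finally show ?thesis .
qed

text \<open>
  The dual norm of the gradient at \<open>w\<close> is at most \<open>\<parallel>w\<parallel>\<^sub>p\<close>: Hoelder's inequality yields
  \<open>\<parallel>u\<parallel>\<^sub>p \<parallel>w\<parallel>\<^sub>p\<^sup>p\<^sup>-\<^sup>1\<close>, and the factor \<open>\<parallel>w\<parallel>\<^sub>p\<^sup>2\<^sup>-\<^sup>p\<close> of the gradient corrects the degree.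
\<close>

lemma Rn_inner_lp_duality_map_le:
  assumes "p \<ge> 2"
  shows "Rn_inner n u (lp_duality_map n p w) \<le> lp_norm n p u * lp_norm n p w"
proof -
  let ?U = "\<Sum>i<n. \<bar>u i\<bar> powr p" and ?W = "\<Sum>i<n. \<bar>w i\<bar> powr p"
  let ?N = "lp_norm n p w"
  have "u i * (w i * \<bar>w i\<bar> powr (p - 2))
      \<le> (\<bar>u i\<bar> powr p) powr (1 / p) * (\<bar>w i\<bar> powr p) powr (1 - 1 / p)" for i
  proof -
    have "u i * (w i * \<bar>w i\<bar> powr (p - 2)) \<le> \<bar>u i\<bar> * (\<bar>w i\<bar> * \<bar>w i\<bar> powr (p - 2))"
      using abs_ge_self[of "u i * (w i * \<bar>w i\<bar> powr (p - 2))"] by (simp add: abs_mult)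
    also have "\<bar>w i\<bar> * \<bar>w i\<bar> powr (p - 2) = \<bar>w i\<bar> powr (p - 1)"
      by (cases "w i = 0") (auto simp: powr_mult_base)
    also have "\<dots> = (\<bar>w i\<bar> powr p) powr (1 - 1 / p)"
      using assms by (simp add: powr_powr algebra_simps)
    also have "\<bar>u i\<bar> = (\<bar>u i\<bar> powr p) powr (1 / p)"
      using assms by (simp add: powr_powr)
    finally show ?thesis .
  qed
  then have "(\<Sum>i<n. u i * (w i * \<bar>w i\<bar> powr (p - 2)))
      \<le> (\<Sum>i<n. (\<bar>u i\<bar> powr p) powr (1 / p) * (\<bar>w i\<bar> powr p) powr (1 - 1 / p))"
    by (rule sum_mono)
  also have "\<dots> \<le> ?U powr (1 / p) * ?W powr (1 - 1 / p)"
    using assms by (intro sum_powr_holder) auto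
  also have "?W powr (1 - 1 / p) = ?N powr (p - 1)"
    using assms by (simp add: lp_norm_def powr_powr field_simps)
  finally have "Rn_inner n u (lp_duality_map n p w) \<le> ?N powr (2 - p) * (lp_norm n p u * ?N powr (p - 1))"
    unfolding Rn_inner_lp_duality_map by (intro mult_left_mono) (auto simp: lp_norm_def)
  also have "\<dots> = lp_norm n p u * (?N powr (2 - p) * ?N powr (p - 1))"
    by simp
  also have "?N powr (2 - p) * ?N powr (p - 1) = ?N"
    using lp_norm_nonneg[of n p w] by (cases "?N = 0") (auto simp: powr_add[symmetric])
  finally show ?thesis .
qed

text \<open>
  The first-order condition for convexity of the squared norm. With \<open>\<langle>w, J w\<rangle> = \<parallel>w\<parallel>\<^sup>2\<close> and
  \<open>\<langle>u, J w\<rangle> \<le> \<parallel>u\<parallel> \<parallel>w\<parallel>\<close> it reduces to \<open>(\<parallel>w\<parallel> - \<parallel>u\<parallel>)\<^sup>2 \<ge> 0\<close>.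
\<close>

lemma lp_norm_square_supporting:
  assumes "p \<ge> 2"
  shows "(lp_norm n p w)\<^sup>2 - (lp_norm n p u)\<^sup>2 \<le> 2 * Rn_inner n (w - u) (lp_duality_map n p w)"
proof -
  have "0 \<le> (lp_norm n p w - lp_norm n p u)\<^sup>2" by simp
  then show ?thesis
    using Rn_inner_lp_duality_map_le[OF assms, of n u w] Rn_inner_lp_duality_map_self[OF assms, of n w]
    by (simp add: Rn_inner_diff_left power2_eq_square algebra_simps)
qed

lemma has_real_derivative_mult_abs_powr:
  fixes q x :: real
  assumes "q > 0"
  shows "((\<lambda>x. x * \<bar>x\<bar> powr q) has_real_derivative (q + 1) * \<bar>x\<bar> powr q) (at x)"
proof (cases "x = 0")
  case True
  have "((\<lambda>h::real. \<bar>h\<bar> powr q) \<longlongrightarrow> 0 powr q) (at 0)"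
    using assms by (intro tendsto_powr' tendsto_rabs_zero tendsto_const) (auto intro: tendsto_ident_at)
  then have "((\<lambda>h::real. h * \<bar>h\<bar> powr q / h) \<longlongrightarrow> 0) (at 0)"
    by (auto elim!: Lim_transform_eventually simp: eventually_at_filter)
  then show ?thesis
    using True assms by (simp add: DERIV_def)
next
  case False
  have "((\<lambda>y. sgn x * y) has_real_derivative sgn x) (at x)"
    by (auto intro!: derivative_eq_intros)
  then have "(abs has_real_derivative sgn x) (at x)"
    by (rule has_field_derivative_transform_within[where d = "\<bar>x\<bar>"])
       (use False in \<open>auto simp: dist_real_def sgn_if split: if_splits\<close>)
  from DERIV_mult[OF DERIV_ident DERIV_chain2[OF has_real_derivative_powr this, of q]]
  have "((\<lambda>x. x * \<bar>x\<bar> powr q) has_real_derivative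
      \<bar>x\<bar> powr q + q * \<bar>x\<bar> powr (q - 1) * sgn x * x) (at x)"
    using False by simp
  moreover have "\<bar>x\<bar> powr (q - 1) * (sgn x * x) = \<bar>x\<bar> powr q"
    using False by (simp add: powr_diff sgn_mult_self_eq abs_sgn[symmetric] mult.commute)
  then have "\<bar>x\<bar> powr q + q * \<bar>x\<bar> powr (q - 1) * sgn x * x = (q + 1) * \<bar>x\<bar> powr q"
    by (simp only: mult.assoc distrib_right mult_1 add.commute)
  ultimately show ?thesis by simp
qed

section \<open>Smoothness of the squared norm\<close>

text \<open>
  For \<open>p = 2\<close> the squared norm is a quadratic form. This case has to be separated: the convention
  \<open>0 powr 0 = 0\<close> makes the formula \<open>p (p - 1) \<bar>x\<bar>\<^sup>p\<^sup>-\<^sup>2\<close> for the second derivative of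
  \<open>\<bar>x\<bar>\<^sup>p\<close> wrong at \<open>x = 0\<close> when \<open>p = 2\<close>.
\<close>

lemma lp_norm_square_smooth_two:
  "(lp_norm n 2 (w + d))\<^sup>2
    = (lp_norm n 2 w)\<^sup>2 + 2 * Rn_inner n d (lp_duality_map n 2 w) + (lp_norm n 2 d)\<^sup>2"
proof -
  have sq: "(lp_norm n 2 u)\<^sup>2 = (\<Sum>i<n. (u i)\<^sup>2)" for u
    by (simp add: lp_norm_square sum_nonneg)
  have "Rn_inner n d (lp_duality_map n 2 w) = (\<Sum>i<n. d i * w i)"
  proof (cases "lp_norm n 2 w = 0")
    case True
    then show ?thesis by (simp add: Rn_inner_lp_duality_map lp_norm_eq_0_iff)
  next
    case False
    then show ?thesis by (auto simp: Rn_inner_lp_duality_map intro!: sum.cong)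
  qed
  then show ?thesis
    by (simp add: sq power2_sum sum.distrib sum_distrib_left mult_ac)
qed

text \<open>
  Taylor's theorem along the segment. With \<open>F(s) = \<parallel>w + s d\<parallel>\<^sup>p\<close> the second derivative of
  \<open>F\<^sup>2\<^sup>/\<^sup>p / 2\<close> is the sum of two terms. The first one carries the factor \<open>2 / p - 1\<close> and is at most
  \<open>0\<close>. The second one contains \<open>\<Sum> d\<^sub>i\<^sup>2 \<bar>w\<^sub>i + s d\<^sub>i\<bar>\<^sup>p\<^sup>-\<^sup>2\<close>, which Hoelder's inequality bounds by
  \<open>\<parallel>d\<parallel>\<^sup>2\<close> times a power of \<open>F\<close> that cancels. A zero of \<open>F\<close> must be excluded, as its negative
  powers enter.
\<close>

lemma lp_norm_square_smooth_nonvanishing: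
  assumes p: "p > 2" and nz: "\<And>s. s \<in> {0..1} \<Longrightarrow> lp_norm n p (w + s *\<^sub>R d) \<noteq> 0"
  shows "(lp_norm n p (w + d))\<^sup>2
    \<le> (lp_norm n p w)\<^sup>2 + 2 * Rn_inner n d (lp_duality_map n p w) + (p - 1) * (lp_norm n p d)\<^sup>2"
proof -
  \<comment> \<open>Up to constants, \<open>G\<close> and \<open>H\<close> are the first and second derivative of \<open>F\<close>;
    \<open>D k\<close> is the \<open>k\<close>-th derivative of half the squared norm.\<close>
  define a where "a = (\<lambda>i s. w i + s * d i)"
  define F where "F = (\<lambda>s. \<Sum>i<n. \<bar>a i s\<bar> powr p)"
  define G where "G = (\<lambda>s. \<Sum>i<n. d i * (a i s * \<bar>a i s\<bar> powr (p - 2)))"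
  define H where "H = (\<lambda>s. \<Sum>i<n. (d i)\<^sup>2 * \<bar>a i s\<bar> powr (p - 2))"
  define D where "D = (\<lambda>(k::nat) s. if k = 0 then F s powr (2 / p) / 2
    else if k = 1 then F s powr (2 / p - 1) * G s
    else (2 / p - 1) * F s powr (2 / p - 2) * (p * G s) * G s
      + F s powr (2 / p - 1) * ((p - 1) * H s))"
  have F0: "F s \<ge> 0" for s by (simp add: F_def sum_nonneg)
  have norm_F: "lp_norm n p (w + s *\<^sub>R d) = F s powr (1 / p)" for s
    by (simp add: lp_norm_def F_def a_def)
  have Fpos: "F s > 0" if "s \<in> {0..1}" for s
    using nz[OF that] F0[of s] by (auto simp: norm_F order.strict_iff_order)
  have da: "(a i has_real_derivative d i) (at s)" for i s
    unfolding a_def by (auto intro!: derivative_eq_intros)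
  have dF: "(F has_real_derivative p * G s) (at s)" for s
  proof -
    have "((\<lambda>x. \<bar>x\<bar> powr p) has_real_derivative p * (x * \<bar>x\<bar> powr (p - 2))) (at x)" for x :: real
      using has_real_derivative_abs_powr[of p 0 x] p by (simp add: mult_abs_powr)
    from DERIV_chain2[OF this da]
    show ?thesis
      unfolding F_def G_def sum_distrib_left
      by (intro DERIV_sum) (auto simp: mult_ac)
  qed
  have dG: "(G has_real_derivative (p - 1) * H s) (at s)" for s
  proof -
    have "((\<lambda>x. x * \<bar>x\<bar> powr (p - 2)) has_real_derivative (p - 1) * \<bar>x\<bar> powr (p - 2)) (at x)" for x :: real
      using has_real_derivative_mult_abs_powr[of "p - 2" x] p by simp
    from DERIV_cmult[OF DERIV_chain2[OF this da]]
    show ?thesis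
      unfolding G_def H_def sum_distrib_left
      by (intro DERIV_sum) (auto simp: mult_ac power2_eq_square)
  qed
  have dpow: "((\<lambda>s. F s powr r) has_real_derivative r * F s powr (r - 1) * (p * G s)) (at s)"
    if "s \<in> {0..1}" for r s
    using DERIV_chain2[OF has_real_derivative_powr[OF Fpos[OF that]] dF] by simp
  have "\<forall>m t. m < 2 \<and> 0 \<le> t \<and> t \<le> 1 \<longrightarrow> DERIV (D m) t :> D (Suc m) t"
  proof (intro allI impI)
    fix m :: nat and t :: real
    assume *: "m < 2 \<and> 0 \<le> t \<and> t \<le> 1"
    then have t: "t \<in> {0..1}" by simp
    consider "m = 0" | "m = 1" using * by linarith
    then show "DERIV (D m) t :> D (Suc m) t"
    proof cases
      case 1
      then show ?thesis
        using DERIV_cdivide[OF dpow[OF t, of "2 / p"], of 2] p by (simp add: D_def)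
    next
      case 2
      then show ?thesis
        using DERIV_mult[OF dpow[OF t, of "2 / p - 1"] dG] by (simp add: D_def mult_ac)
    qed
  qed
  from Maclaurin2[OF zero_less_one refl this]
  obtain t where "0 < t" "t \<le> 1" and taylor: "D 0 1 = D 0 0 + D 1 0 + D 2 t / 2"
    by (auto simp: numeral_2_eq_2)
  then have t: "t \<in> {0..1}" by simp
  have "D 2 t \<le> F t powr (2 / p - 1) * ((p - 1) * H t)"
  proof -
    have "(2 / p - 1) * (F t powr (2 / p - 2) * (p * (G t * G t))) \<le> 0"
      using p by (intro mult_nonpos_nonneg mult_nonneg_nonneg zero_le_square) auto
    then show ?thesis by (simp add: D_def mult_ac)
  qed
  also have "H t \<le> (lp_norm n p d)\<^sup>2 * F t powr (1 - 2 / p)"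
  proof -
    have "H t = (\<Sum>i<n. (\<bar>d i\<bar> powr p) powr (2 / p) * (\<bar>a i t\<bar> powr p) powr (1 - 2 / p))"
      unfolding H_def using p by (intro sum.cong) (auto simp: powr_powr algebra_simps)
    also have "\<dots> \<le> (\<Sum>i<n. \<bar>d i\<bar> powr p) powr (2 / p) * F t powr (1 - 2 / p)"
      unfolding F_def using p by (intro sum_powr_holder) auto
    finally show ?thesis by (simp add: lp_norm_square)
  qed
  also have "F t powr (2 / p - 1) * ((p - 1) * ((lp_norm n p d)\<^sup>2 * F t powr (1 - 2 / p)))
      = (p - 1) * (lp_norm n p d)\<^sup>2 * (F t powr (2 / p - 1) * F t powr (1 - 2 / p))"
    by simp
  also have "F t powr (2 / p - 1) * F t powr (1 - 2 / p) = 1"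
    using Fpos[OF t] by (simp add: powr_add[symmetric])
  finally have D2: "D 2 t \<le> (p - 1) * (lp_norm n p d)\<^sup>2"
    using p by (simp add: mult_left_mono)
  have "(lp_norm n p (w + s *\<^sub>R d))\<^sup>2 = 2 * D 0 s" for s
    by (simp add: D_def lp_norm_square F_def a_def)
  from this[of 1] this[of 0]
  have D0: "(lp_norm n p (w + d))\<^sup>2 = 2 * D 0 1" "(lp_norm n p w)\<^sup>2 = 2 * D 0 0"
    by (simp_all add: scaleR_fun_def plus_fun_def)
  have D1: "Rn_inner n d (lp_duality_map n p w) = D 1 0"
    using p by (simp add: D_def Rn_inner_lp_duality_map G_def F_def a_def lp_norm_def powr_powr field_simps)
  show ?thesis
    unfolding D0 D1 using taylor D2 by simp
qed

text \<open>
  If the line through \<open>w\<close> in the direction \<open>d\<close> meets the origin, then \<open>w\<close> is a multiple of \<open>d\<close>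
  and the claim reduces to a quadratic identity in one variable and \<open>1 \<le> p - 1\<close>.
\<close>

lemma lp_norm_square_smooth:
  assumes p: "p \<ge> 2"
  shows "(lp_norm n p (w + d))\<^sup>2
    \<le> (lp_norm n p w)\<^sup>2 + 2 * Rn_inner n d (lp_duality_map n p w) + (p - 1) * (lp_norm n p d)\<^sup>2"
proof -
  consider "p = 2" | "p > 2" "\<exists>s. lp_norm n p (w + s *\<^sub>R d) = 0"
    | "p > 2" "\<forall>s. lp_norm n p (w + s *\<^sub>R d) \<noteq> 0"
    using p by fastforce
  then show ?thesis
  proof cases
    case 1
    then show ?thesis by (simp add: lp_norm_square_smooth_two)
  next
    case 2
    let ?N = "lp_norm n p d"
    from 2 obtain s where "lp_norm n p (w + s *\<^sub>R d) = 0" by blast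
    then have w: "w i = - s * d i" if "i < n" for i
      using that by (auto simp: lp_norm_eq_0_iff eq_neg_iff_add_eq_0)
    have "lp_norm n p w = lp_norm n p ((- s) *\<^sub>R d)"
      by (rule lp_norm_cong) (simp add: w)
    then have Nw: "lp_norm n p w = \<bar>s\<bar> * ?N"
      using p lp_norm_scaleR[of p n "- s" d] by simp
    have "lp_norm n p (w + d) = lp_norm n p ((1 - s) *\<^sub>R d)"
      by (rule lp_norm_cong) (simp add: w algebra_simps)
    then have Nwd: "lp_norm n p (w + d) = \<bar>1 - s\<bar> * ?N"
      using p by (simp add: lp_norm_scaleR)
    have "Rn_inner n w (lp_duality_map n p w) = - s * Rn_inner n d (lp_duality_map n p w)"
      unfolding Rn_inner_def sum_distrib_left by (rule sum.cong) (simp_all add: w)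
    then have "- s * Rn_inner n d (lp_duality_map n p w) = s\<^sup>2 * ?N\<^sup>2"
      using p by (simp add: Rn_inner_lp_duality_map_self Nw power_mult_distrib)
    moreover have "Rn_inner n d (lp_duality_map n p w) = 0" if "s = 0"
      using that by (simp add: Rn_inner_lp_duality_map w)
    ultimately have "Rn_inner n d (lp_duality_map n p w) = - s * ?N\<^sup>2"
      using mult_left_cancel[of "- s" "Rn_inner n d (lp_duality_map n p w)" "- s * ?N\<^sup>2"]
      by (cases "s = 0") (simp_all add: power2_eq_square mult_ac)
    moreover have "1 * ?N\<^sup>2 \<le> (p - 1) * ?N\<^sup>2"
      using p by (intro mult_right_mono) auto
    ultimately show ?thesis
      by (simp add: Nw Nwd power_mult_distrib) (simp add: power2_eq_square algebra_simps)
  next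
    case 3
    then show ?thesis by (intro lp_norm_square_smooth_nonvanishing) auto
  qed
qed


section \<open>One Frank-Wolfe step\<close>

text \<open>
  Compare \<open>v\<close> with the points \<open>(1 - s) x + s v + (1 - s) s \<alpha> \<parallel>x - v\<parallel>\<^sup>2 z\<close> of \<open>C\<close> for
  \<open>z = - w / \<parallel>w\<parallel>\<close>, where \<open>\<langle>z, J w\<rangle> = - \<parallel>w\<parallel>\<close>. Dividing by \<open>1 - s\<close> leaves the factor \<open>s\<close>,
  which disappears as \<open>s\<close> tends to \<open>1\<close>: the sharp constant comes from points close to \<open>v\<close>.
\<close>

lemma strongly_convex_linear_minimization_gap:
  assumes p: "p \<ge> 2" and C: "strongly_convex n (lp_norm n p) \<alpha> C"
    and x: "x \<in> C" and v: "v \<in> C" and w: "w \<in> Rn n"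
    and min: "\<And>y. y \<in> C \<Longrightarrow> Rn_inner n v (lp_duality_map n p w) \<le> Rn_inner n y (lp_duality_map n p w)"
  shows "\<alpha> * (lp_norm n p (x - v))\<^sup>2 * lp_norm n p w \<le> Rn_inner n (x - v) (lp_duality_map n p w)"
proof (cases "lp_norm n p w = 0")
  case True
  then show ?thesis using min[OF x] by (simp add: Rn_inner_diff_left)
next
  case False
  let ?J = "lp_duality_map n p w" and ?N = "lp_norm n p w"
  let ?D = "(lp_norm n p (x - v))\<^sup>2" and ?g = "Rn_inner n (x - v) (lp_duality_map n p w)"
  have N: "?N > 0" using False lp_norm_nonneg[of n p w] by simp
  define z where "z = (- (1 / ?N)) *\<^sub>R w"
  have z: "z \<in> Rn n" using w by (simp add: z_def Rn_def scaleR_fun_def)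
  have Nz: "lp_norm n p z = 1"
    unfolding z_def using p N by (subst lp_norm_scaleR) auto
  have Jz: "Rn_inner n z ?J = - ?N"
    unfolding z_def Rn_inner_scaleR_left Rn_inner_lp_duality_map_self[OF p]
    using N by (simp add: power2_eq_square)
  show ?thesis
  proof (rule field_le_mult_one_interval)
    fix s :: real assume s: "0 < s" "s < 1"
    have "(1 - s) *\<^sub>R x + s *\<^sub>R v + ((1 - s) * s * \<alpha> * ?D) *\<^sub>R z \<in> C"
      using C x v z Nz s unfolding strongly_convex_def by auto
    from min[OF this]
    have "(1 - s) * (s * (\<alpha> * ?D * ?N)) \<le> (1 - s) * ?g"
      by (simp add: Rn_inner_add_left Rn_inner_diff_left Rn_inner_scaleR_left Jz algebra_simps)
    then show "s * (\<alpha> * ?D * ?N) \<le> ?g"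
      using s by (simp add: mult_le_cancel_left)
  qed
qed

text \<open>
  The squared length \<open>D\<close> of the full step occurs both in the lower bound on the gap \<open>g\<close> and in the
  denominator of the step size. It cancels, so the bound is the same for all iterates.
\<close>

lemma closed_loop_step_size_lower_bound:
  assumes p: "p \<ge> 2" and D: "D > 0" and c: "c \<le> N" and \<alpha>: "\<alpha> > 0" and g: "\<alpha> * D * N \<le> g"
  shows "min 1 (\<alpha> * c / (p - 1)) \<le> min (g / ((p - 1) * D)) (1::real)"
proof -
  have "\<alpha> * D * c \<le> \<alpha> * D * N"
    using c \<alpha> D by (intro mult_left_mono) auto
  also note g
  finally have "\<alpha> * D * c / ((p - 1) * D) \<le> g / ((p - 1) * D)"
    using p D by (intro divide_right_mono) auto
  then have "\<alpha> * c / (p - 1) \<le> g / ((p - 1) * D)"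
    using D by simp
  then show ?thesis by linarith
qed

text \<open>
  The point \<open>y\<close> stands for a minimizer of the distance to \<open>xs\<close>. A step of size
  \<open>\<gamma> \<ge> \<rho>\<close> lowers the error \<open>h\<close> by at least \<open>\<gamma> g \<ge> \<rho> h / 2\<close>. When \<open>v = x\<close>, the gap \<open>g\<close> is zero,
  so \<open>x\<close> is already as close to \<open>xs\<close> as \<open>y\<close>, and both sides vanish.
\<close>

lemma frank_wolfe_step_contraction:
  assumes p: "p \<ge> 2" and C: "strongly_convex n (lp_norm n p) \<alpha> C"
    and sub: "C \<subseteq> Rn n" and xs: "xs \<in> Rn n"
    and x: "x \<in> C" and v: "v \<in> C" and y: "y \<in> C"
    and c: "lp_norm n p (y - xs) \<le> lp_norm n p (x - xs)"
    and min: "\<And>u. u \<in> C \<Longrightarrow> Rn_inner n v (lp_duality_map n p (x - xs))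
                \<le> Rn_inner n u (lp_duality_map n p (x - xs))"
    and \<gamma>: "v \<noteq> x \<Longrightarrow> \<gamma> = min (Rn_inner n (x - v) (lp_duality_map n p (x - xs)) /
                  ((p - 1) * (lp_norm n p (x - v))\<^sup>2)) 1"
  shows "(lp_norm n p (x + \<gamma> *\<^sub>R (v - x) - xs))\<^sup>2 - (lp_norm n p (y - xs))\<^sup>2
    \<le> (1 - min 1 (\<alpha> * lp_norm n p (y - xs) / (p - 1)) / 2)
        * ((lp_norm n p (x - xs))\<^sup>2 - (lp_norm n p (y - xs))\<^sup>2)"
    and "v \<noteq> x \<Longrightarrow> min 1 (\<alpha> * lp_norm n p (y - xs) / (p - 1)) \<le> \<gamma>"
proof -
  define w where "w = x - xs"
  define g where "g = Rn_inner n (x - v) (lp_duality_map n p w)"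
  define D where "D = (lp_norm n p (x - v))\<^sup>2"
  define h where "h = (lp_norm n p w)\<^sup>2 - (lp_norm n p (y - xs))\<^sup>2"
  define \<rho> where "\<rho> = min 1 (\<alpha> * lp_norm n p (y - xs) / (p - 1))"
  have w: "w \<in> Rn n"
    using x sub xs by (auto simp: w_def Rn_def)
  have \<alpha>: "\<alpha> > 0" using C by (simp add: strongly_convex_def)
  have "h \<le> 2 * Rn_inner n (w - (y - xs)) (lp_duality_map n p w)"
    unfolding h_def by (rule lp_norm_square_supporting[OF p])
  also have "\<dots> \<le> 2 * g"
    using min[OF y] by (simp add: g_def w_def Rn_inner_diff_left)
  finally have hg: "h \<le> 2 * g" .
  have gap: "\<alpha> * D * lp_norm n p w \<le> g"
    unfolding D_def g_def
    by (rule strongly_convex_linear_minimization_gap[OF p C x v w]) (use min in \<open>simp add: w_def\<close>)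
  have h0: "0 \<le> h"
    using c lp_norm_nonneg by (simp add: h_def w_def power_mono)
  have \<rho>0: "0 \<le> \<rho>"
    using \<alpha> p lp_norm_nonneg[of n p "y - xs"] by (simp add: \<rho>_def)
  have step: "\<rho> \<le> \<gamma>" "(lp_norm n p (x + \<gamma> *\<^sub>R (v - x) - xs))\<^sup>2 - (lp_norm n p w)\<^sup>2 \<le> - \<gamma> * g"
    if "v \<noteq> x"
  proof -
    have "D \<noteq> 0"
    proof
      assume "D = 0"
      then show False
        using lp_norm_diff_eq_0_iff[of x n v p] x v sub that by (auto simp: D_def)
    qed
    then have D: "D > 0" by (simp add: D_def)
    have \<gamma>': "\<gamma> = min (g / ((p - 1) * D)) 1"
      using \<gamma>[OF that] by (simp add: g_def D_def w_def)
    show "\<rho> \<le> \<gamma>"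
      unfolding \<gamma>' \<rho>_def
      by (rule closed_loop_step_size_lower_bound[OF p D _ \<alpha> gap]) (use c in \<open>simp add: w_def\<close>)
    then have \<gamma>0: "\<gamma> \<ge> 0" using \<rho>0 by simp
    have "\<gamma> \<le> g / ((p - 1) * D)" by (simp add: \<gamma>')
    then have "\<gamma> * ((p - 1) * D) \<le> g"
      using p D by (simp add: pos_le_divide_eq)
    \<comment> \<open>The quadratic term of the smoothness bound uses up at most half of the linear decrease.\<close>
    then have short: "\<gamma> * (\<gamma> * ((p - 1) * D)) \<le> \<gamma> * g"
      using \<gamma>0 by (rule mult_left_mono)
    have "x + \<gamma> *\<^sub>R (v - x) - xs = w + (- \<gamma>) *\<^sub>R (x - v)"
      by (simp add: w_def algebra_simps)
    then have "(lp_norm n p (x + \<gamma> *\<^sub>R (v - x) - xs))\<^sup>2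
        \<le> (lp_norm n p w)\<^sup>2 + 2 * Rn_inner n ((- \<gamma>) *\<^sub>R (x - v)) (lp_duality_map n p w)
          + (p - 1) * (lp_norm n p ((- \<gamma>) *\<^sub>R (x - v)))\<^sup>2"
      using lp_norm_square_smooth[OF p] by (simp only:)
    also have "\<dots> = (lp_norm n p w)\<^sup>2 - 2 * \<gamma> * g + \<gamma> * (\<gamma> * ((p - 1) * D))"
      using p unfolding Rn_inner_scaleR_left
      by (subst lp_norm_scaleR) (auto simp: g_def D_def power_mult_distrib power2_eq_square)
    finally show "(lp_norm n p (x + \<gamma> *\<^sub>R (v - x) - xs))\<^sup>2 - (lp_norm n p w)\<^sup>2 \<le> - \<gamma> * g"
      using short by simp
  qed
  show "min 1 (\<alpha> * lp_norm n p (y - xs) / (p - 1)) \<le> \<gamma>" if "v \<noteq> x"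
    using step(1)[OF that] by (simp add: \<rho>_def)
  have "(lp_norm n p (x + \<gamma> *\<^sub>R (v - x) - xs))\<^sup>2 - (lp_norm n p (y - xs))\<^sup>2 \<le> (1 - \<rho> / 2) * h"
  proof (cases "v = x")
    case True
    then have "g = 0" by (simp add: g_def Rn_inner_def)
    then have "h = 0" using hg h0 by simp
    then show ?thesis using True by (simp add: h_def w_def)
  next
    case False
    have "\<rho> * (h / 2) \<le> \<gamma> * g"
      using step(1)[OF False] \<rho>0 hg h0 by (intro mult_mono) auto
    then show ?thesis using step(2)[OF False] by (simp add: h_def algebra_simps)
  qed
  then show "(lp_norm n p (x + \<gamma> *\<^sub>R (v - x) - xs))\<^sup>2 - (lp_norm n p (y - xs))\<^sup>2
    \<le> (1 - min 1 (\<alpha> * lp_norm n p (y - xs) / (p - 1)) / 2)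
        * ((lp_norm n p (x - xs))\<^sup>2 - (lp_norm n p (y - xs))\<^sup>2)"
    by (simp add: \<rho>_def h_def w_def)
qed

section \<open>Cardinality of the iterates\<close>

lemma fw_cardinality_le_Suc: "fw_cardinality x0 V \<gamma> t \<le> Suc t"
proof -
  have "fw_cardinality x0 V \<gamma> t \<le> card (insert x0 (V ` {..<t}))"
    unfolding fw_cardinality_def by (intro card_mono) auto
  also have "\<dots> \<le> Suc (card (V ` {..<t}))"
    by (rule card_insert_le_m1) auto
  also have "card (V ` {..<t}) \<le> t"
    using card_image_le[of "{..<t}" V] by simp
  finally show ?thesis by simp
qed

text \<open>
  A full step moves all the weight to the new vertex. A step with \<open>V t = X t\<close> may have an arbitrary
  size, but it moves weight from the current vertex to itself.
\<close>

lemma fw_cardinality_full_steps: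
  assumes "frank_wolfe n f C X V \<gamma>" and full: "\<And>t. V t \<noteq> X t \<Longrightarrow> \<gamma> t = 1"
  shows "fw_cardinality (X 0) V \<gamma> t \<le> 1"
proof -
  have "fw_weight (X 0) V \<gamma> t u = (if u = X t then 1 else 0)" for u
  proof (induction t)
    case (Suc t)
    have "X (Suc t) = X t + \<gamma> t *\<^sub>R (V t - X t)"
      using assms(1) by (simp add: frank_wolfe_def)
    then have "X (Suc t) = V t \<or> V t = X t \<and> X (Suc t) = X t"
      using full[of t] by (cases "V t = X t") auto
    then show ?case using Suc full[of t] by (cases "V t = X t") auto
  qed simp
  then have "{u \<in> insert (X 0) (V ` {..<t}). fw_weight (X 0) V \<gamma> t u > 0} \<subseteq> {X t}"
    by (auto split: if_splits)
  from card_mono[OF _ this] show ?thesis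
    by (simp add: fw_cardinality_def)
qed

section \<open>Linear convergence and the cardinality bound\<close>

lemma continuous_on_lp_norm_diff:
  assumes "p > 0"
  shows "continuous_on S (\<lambda>y. lp_norm n p (y - a))"
  unfolding lp_norm_def using assms
  by (intro continuous_on_powr' continuous_intros) (auto intro!: sum_nonneg continuous_on_diff continuous_on_const
      continuous_on_subset[OF continuous_on_product_coordinates])

lemma gradient_half_lp_norm_square_eq_lp_duality_map:
  assumes "2 \<le> p" "x \<in> Rn n" "xs \<in> Rn n" "x \<noteq> xs"
  shows "gradient n (\<lambda>x. (lp_norm n p (x - xs))\<^sup>2 / 2) x = lp_duality_map n p (x - xs)"
proof
  fix i
  show "gradient n (\<lambda>x. (lp_norm n p (x - xs))\<^sup>2 / 2) x i = lp_duality_map n p (x - xs) i"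
  proof (cases "i < n")
    case True
    show ?thesis
      unfolding gradient_half_lp_norm_sq[OF assms True] lp_duality_map_def mult_abs_powr
      by (simp add: mult.assoc)
  next
    case False
    then show ?thesis using assms by (simp add: gradient_def lp_duality_map_def Rn_def)
  qed
qed

lemma frank_wolfe_linear_convergence:
  assumes p: "p \<ge> 2" and C: "strongly_convex n (lp_norm n p) \<alpha> C" "convex C"
    and sub: "C \<subseteq> Rn n" and xs: "xs \<in> Rn n - C"
    and y: "y \<in> C" "\<forall>x\<in>C. lp_norm n p (y - xs) \<le> lp_norm n p (x - xs)"
    and f: "f = (\<lambda>x. (lp_norm n p (x - xs))\<^sup>2 / 2)"
    and fw: "frank_wolfe n f C X V \<gamma>" and cl: "closed_loop n p f X V \<gamma>"
  defines "\<rho> \<equiv> min 1 (\<alpha> * lp_norm n p (y - xs) / (p - 1))"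
  shows "X t \<in> C"
    and "(lp_norm n p (X t - xs))\<^sup>2 - (lp_norm n p (y - xs))\<^sup>2
      \<le> (1 - \<rho> / 2) ^ t * ((lp_norm n p (X 0 - xs))\<^sup>2 - (lp_norm n p (y - xs))\<^sup>2)"
    and "V t \<noteq> X t \<Longrightarrow> \<rho> \<le> \<gamma> t"
proof -
  have X: "X t \<in> C" for t
  proof (induction t)
    case 0
    then show ?case using fw by (auto simp: frank_wolfe_def extreme_point_of_def)
  next
    case (Suc t)
    have "V t \<in> C" "\<gamma> t \<in> {0..1}"
      using fw by (auto simp: frank_wolfe_def extreme_point_of_def)
    then have "(1 - \<gamma> t) *\<^sub>R X t + \<gamma> t *\<^sub>R V t \<in> C"
      using Suc C(2) by (intro convexD) auto
    moreover have "X (Suc t) = (1 - \<gamma> t) *\<^sub>R X t + \<gamma> t *\<^sub>R V t"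
      using fw by (simp add: frank_wolfe_def algebra_simps)
    ultimately show ?case by (simp only:)
  qed
  have step: "(lp_norm n p (X (Suc t) - xs))\<^sup>2 - (lp_norm n p (y - xs))\<^sup>2
      \<le> (1 - \<rho> / 2) * ((lp_norm n p (X t - xs))\<^sup>2 - (lp_norm n p (y - xs))\<^sup>2)"
    "V t \<noteq> X t \<Longrightarrow> \<rho> \<le> \<gamma> t" for t
  proof -
    have grad: "gradient n f (X t) = lp_duality_map n p (X t - xs)"
      unfolding f using X[of t] sub xs p
      by (intro gradient_half_lp_norm_square_eq_lp_duality_map) auto
    have fw_t: "is_arg_min (\<lambda>v. Rn_inner n v (gradient n f (X t))) (\<lambda>v. v \<in> C) (V t)"
        "X (Suc t) = X t + \<gamma> t *\<^sub>R (V t - X t)"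
      using fw by (simp_all add: frank_wolfe_def)
    have V: "V t \<in> C"
      using fw_t by (simp add: is_arg_min_linorder)
    have min: "Rn_inner n (V t) (lp_duality_map n p (X t - xs))
          \<le> Rn_inner n u (lp_duality_map n p (X t - xs))" if "u \<in> C" for u
      using fw_t(1) that by (auto simp: is_arg_min_linorder grad)
    have \<gamma>: "\<gamma> t = min (Rn_inner n (X t - V t) (lp_duality_map n p (X t - xs)) /
                  ((p - 1) * (lp_norm n p (X t - V t))\<^sup>2)) 1" if "V t \<noteq> X t"
      using cl that by (simp add: closed_loop_def grad)
    note contraction = frank_wolfe_step_contraction
      [OF p C(1) sub _ X V y(1) bspec[OF y(2) X] min \<gamma>, folded \<rho>_def]
    show "(lp_norm n p (X (Suc t) - xs))\<^sup>2 - (lp_norm n p (y - xs))\<^sup>2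
      \<le> (1 - \<rho> / 2) * ((lp_norm n p (X t - xs))\<^sup>2 - (lp_norm n p (y - xs))\<^sup>2)"
      unfolding fw_t(2) using contraction(1) xs y(1) by auto
    show "V t \<noteq> X t \<Longrightarrow> \<rho> \<le> \<gamma> t"
      using contraction(2) xs y(1) by auto
  qed
  show "X t \<in> C" by (rule X)
  show "V t \<noteq> X t \<Longrightarrow> \<rho> \<le> \<gamma> t" by (rule step)
  have "\<rho> \<le> 1" by (simp add: \<rho>_def)
  show "(lp_norm n p (X t - xs))\<^sup>2 - (lp_norm n p (y - xs))\<^sup>2
      \<le> (1 - \<rho> / 2) ^ t * ((lp_norm n p (X 0 - xs))\<^sup>2 - (lp_norm n p (y - xs))\<^sup>2)"
  proof (induction t)
    case (Suc t)
    have "(1 - \<rho> / 2) * ((lp_norm n p (X t - xs))\<^sup>2 - (lp_norm n p (y - xs))\<^sup>2)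
        \<le> (1 - \<rho> / 2) * ((1 - \<rho> / 2) ^ t * ((lp_norm n p (X 0 - xs))\<^sup>2 - (lp_norm n p (y - xs))\<^sup>2))"
      using \<open>\<rho> \<le> 1\<close> by (intro mult_left_mono Suc.IH) simp
    with step(1)[of t] show ?case
      unfolding power_Suc mult.assoc by (rule order_trans)
  qed simp
qed

text \<open>
  After \<open>6 ln (1 / \<epsilon>) / \<rho>\<close> steps the contraction factor is at most \<open>\<epsilon>\<^sup>3\<close>: one factor \<open>\<epsilon>\<close> absorbs
  the initial error \<open>M \<le> 1 / \<epsilon>\<close>, and the other two are the required accuracy.
\<close>

lemma linear_rate_reaches_accuracy:
  fixes \<rho> M \<epsilon> :: real
  assumes \<rho>: "0 < \<rho>" "\<rho> \<le> 1" and M: "M > 0" and \<epsilon>: "0 < \<epsilon>" "\<epsilon> \<le> 1 / M"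
    and t: "6 * ln (1 / \<epsilon>) / \<rho> \<le> real t"
  shows "(1 - \<rho> / 2) ^ t * M \<le> \<epsilon>\<^sup>2"
proof -
  have "(1 - \<rho> / 2) ^ t \<le> exp (- (\<rho> / 2)) ^ t"
    using \<rho> exp_ge_add_one_self[of "- (\<rho> / 2)"] by (intro power_mono) auto
  also have "\<dots> = exp (- (\<rho> * real t / 2))"
    by (simp add: exp_of_nat_mult[symmetric] algebra_simps)
  also have "\<dots> \<le> exp (- (3 * ln (1 / \<epsilon>)))"
    using t \<rho> by (simp add: field_simps)
  also have "\<dots> = \<epsilon> ^ 3"
    using \<epsilon> by (simp add: ln_div exp_of_nat_mult[of 3 "ln \<epsilon>", simplified])
  finally have "(1 - \<rho> / 2) ^ t * M \<le> \<epsilon> ^ 3 * (1 / \<epsilon>)"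
    using M \<epsilon> by (intro mult_mono) (auto simp: field_simps)
  then show ?thesis using \<epsilon> by (simp add: power3_eq_cube power2_eq_square)
qed

theorem corollary7p1:
  "\<exists>K::real. K > 0 \<and>
    (\<forall>(n::nat) (p::real) (\<alpha>::real) (C::(nat \<Rightarrow> real) set) (xstar::nat \<Rightarrow> real).
      p \<ge> 2 \<and> C \<subseteq> Rn n \<and> C \<noteq> {} \<and> compact C \<and> convex C \<and>
      strongly_convex n (lp_norm n p) \<alpha> C \<and>
      xstar \<in> Rn n - C \<longrightarrow>
      (let c = lp_dist n p xstar C;
           f = (\<lambda>x. (lp_norm n p (x - xstar))\<^sup>2 / 2)
       in \<exists>\<epsilon>0::real. 0 < \<epsilon>0 \<and> \<epsilon>0 < 1 \<and>
          (\<forall>(X::nat \<Rightarrow> nat \<Rightarrow> real) (V::nat \<Rightarrow> nat \<Rightarrow> real) (\<gamma>::nat \<Rightarrow> real).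
             frank_wolfe n f C X V \<gamma> \<and> closed_loop n p f X V \<gamma> \<longrightarrow>
             (\<forall>\<epsilon>. 0 < \<epsilon> \<and> \<epsilon> < \<epsilon>0 \<longrightarrow>
               (\<exists>t. X t \<in> C \<and>
                    (lp_norm n p (X t - xstar))\<^sup>2 - c\<^sup>2 \<le> \<epsilon>\<^sup>2 \<and>
                    real (fw_cardinality (X 0) V \<gamma> t)
                      \<le> K * max 1 (p / (c * \<alpha>) * ln (1 / \<epsilon>)))))))"
  unfolding Let_def
  \<comment> \<open>The constant \<open>8\<close> leaves room for six times the logarithmic term, one for rounding up the number
    of iterations, and one for the initial vertex.\<close>
proof (rule exI[of _ 8], intro conjI allI impI)
  show "(0::real) < 8" by simp
next
  fix n :: nat and p \<alpha> :: real and C :: "(nat \<Rightarrow> real) set" and xstar :: "nat \<Rightarrow> real"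
  let ?N = "\<lambda>x. lp_norm n p (x - xstar)" and ?c = "lp_dist n p xstar C"
  let ?f = "\<lambda>x. (?N x)\<^sup>2 / 2"
  assume H: "p \<ge> 2 \<and> C \<subseteq> Rn n \<and> C \<noteq> {} \<and> compact C \<and> convex C \<and>
      strongly_convex n (lp_norm n p) \<alpha> C \<and> xstar \<in> Rn n - C"
  then have p: "p \<ge> 2" and sub: "C \<subseteq> Rn n" and xs: "xstar \<in> Rn n - C" "xstar \<notin> C"
    and C: "strongly_convex n (lp_norm n p) \<alpha> C" "convex C" and \<alpha>: "\<alpha> > 0"
    by (auto simp: strongly_convex_def)
  have cont: "continuous_on C ?N"
    using p by (intro continuous_on_lp_norm_diff) auto
  obtain y where y: "y \<in> C" "\<forall>x\<in>C. ?N y \<le> ?N x"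
    using continuous_attains_inf[OF _ _ cont] H by blast
  obtain b where b: "b \<in> C" "\<And>x. x \<in> C \<Longrightarrow> ?N x \<le> ?N b"
    using continuous_attains_sup[OF _ _ cont] H by blast
  have c: "?c = ?N y"
    unfolding lp_dist_def using y by (intro cInf_eq_minimum) auto
  have "?N y \<noteq> 0"
  proof
    assume "?N y = 0"
    then have "y = xstar"
      using y(1) sub xs by (subst (asm) lp_norm_diff_eq_0_iff) auto
    then show False using y(1) xs by simp
  qed
  then have c0: "?c > 0" using lp_norm_nonneg[of n p "y - xstar"] by (simp add: c)
  \<comment> \<open>A bound on the initial error that is the same for all runs; the summand \<open>2\<close> makes the
    threshold \<open>1 / M\<close> smaller than \<open>1\<close>.\<close>
  define M where "M = (?N b)\<^sup>2 + 2"
  have M: "M > 1" unfolding M_def using zero_le_power2[of "?N b"] by linarith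
  define \<rho> where "\<rho> = min 1 (\<alpha> * ?N y / (p - 1))"
  have \<rho>: "0 < \<rho>" "\<rho> \<le> 1"
    using \<alpha> c0 p by (auto simp: \<rho>_def c)
  show "\<exists>\<epsilon>0::real. 0 < \<epsilon>0 \<and> \<epsilon>0 < 1 \<and>
          (\<forall>(X::nat \<Rightarrow> nat \<Rightarrow> real) (V::nat \<Rightarrow> nat \<Rightarrow> real) (\<gamma>::nat \<Rightarrow> real).
             frank_wolfe n ?f C X V \<gamma> \<and> closed_loop n p ?f X V \<gamma> \<longrightarrow>
             (\<forall>\<epsilon>. 0 < \<epsilon> \<and> \<epsilon> < \<epsilon>0 \<longrightarrow>
               (\<exists>t. X t \<in> C \<and> (?N (X t))\<^sup>2 - ?c\<^sup>2 \<le> \<epsilon>\<^sup>2 \<and>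
                    real (fw_cardinality (X 0) V \<gamma> t) \<le> 8 * max 1 (p / (?c * \<alpha>) * ln (1 / \<epsilon>)))))"
  proof (rule exI[of _ "1 / M"], intro conjI allI impI)
    show "0 < 1 / M" "1 / M < 1" using M by auto
  next
    fix X V :: "nat \<Rightarrow> nat \<Rightarrow> real" and \<gamma> :: "nat \<Rightarrow> real" and \<epsilon> :: real
    assume run: "frank_wolfe n ?f C X V \<gamma> \<and> closed_loop n p ?f X V \<gamma>"
      and \<epsilon>: "0 < \<epsilon> \<and> \<epsilon> < 1 / M"
    note conv = frank_wolfe_linear_convergence
      [OF p C sub xs(1) y refl conjunct1[OF run] conjunct2[OF run], folded \<rho>_def]
    define L where "L = ln (1 / \<epsilon>)"
    have "\<epsilon> < 1" using \<epsilon> M less_divide_eq_1_pos[of M 1] by (smt (verit) divide_less_eq_1_pos)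
    then have L: "L > 0" using \<epsilon> by (simp add: L_def)
    define t where "t = nat \<lceil>6 * L / \<rho>\<rceil>"
    have t: "6 * L / \<rho> \<le> real t" "real t \<le> 6 * L / \<rho> + 1"
      using L \<rho> by (auto simp: t_def)
    have "(?N (X t))\<^sup>2 - ?c\<^sup>2 \<le> (1 - \<rho> / 2) ^ t * ((?N (X 0))\<^sup>2 - (?N y)\<^sup>2)"
      using conv(2) by (simp add: c)
    also have "\<dots> \<le> (1 - \<rho> / 2) ^ t * M"
    proof (rule mult_left_mono)
      have "(?N (X 0))\<^sup>2 \<le> (?N b)\<^sup>2"
        using b(2)[OF conv(1)] lp_norm_nonneg by (rule power_mono)
      then show "(?N (X 0))\<^sup>2 - (?N y)\<^sup>2 \<le> M"
        unfolding M_def using zero_le_power2[of "?N y"] by linarith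
    qed (use \<rho> in simp)
    also have "\<dots> \<le> \<epsilon>\<^sup>2"
      using \<rho> M \<epsilon> t(1) unfolding L_def by (intro linear_rate_reaches_accuracy) auto
    finally have accuracy: "(?N (X t))\<^sup>2 - ?c\<^sup>2 \<le> \<epsilon>\<^sup>2" .
    have "real (fw_cardinality (X 0) V \<gamma> t) \<le> 8 * max 1 (p / (?c * \<alpha>) * L)"
    proof (cases "\<rho> = 1")
      case True
      have "\<gamma> t = 1" if "V t \<noteq> X t" for t
      proof -
        have "\<gamma> t \<le> 1" using run by (auto simp: frank_wolfe_def)
        then show ?thesis using conv(3)[OF that] True by simp
      qed
      from fw_cardinality_full_steps[OF conjunct1[OF run] this, of t]
      show ?thesis by (simp add: max_def)
    next
      case False
      then have "\<rho> = \<alpha> * ?c / (p - 1)" by (auto simp: \<rho>_def c min_def)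
      then have "6 * L / \<rho> = 6 * ((p - 1) / (?c * \<alpha>) * L)"
        by (simp add: mult_ac)
      also have "(p - 1) / (?c * \<alpha>) * L \<le> p / (?c * \<alpha>) * L"
        using L c0 \<alpha> by (intro mult_right_mono divide_right_mono) auto
      finally have "real t \<le> 6 * (p / (?c * \<alpha>) * L) + 1"
        using t(2) by simp
      then show ?thesis
        using fw_cardinality_le_Suc[of "X 0" V \<gamma> t] by linarith
    qed
    then show "\<exists>t. X t \<in> C \<and> (?N (X t))\<^sup>2 - ?c\<^sup>2 \<le> \<epsilon>\<^sup>2 \<and>
        real (fw_cardinality (X 0) V \<gamma> t) \<le> 8 * max 1 (p / (?c * \<alpha>) * ln (1 / \<epsilon>))"
      using conv(1) accuracy unfolding L_def by blast
  qed
qed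

end
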